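(* Let $\Delta=\mathrm{diag}(b_1,b_2,b_3)$ with $b_1,b_2,b_3$ distinct nonzero complex numbers, and let $\mathcal L$ be a subspace of $M_3[\mathbb C]$ that is $\Delta$-singular and satisfies $\dim\mathcal L=5$ and $\dim\mathcal L_0=2$, where $\mathcal L_0=\mathcal L\cap\mathcal M_3$. Let $(L_1,L_2)$ be the canonical basis of $\mathcal L_0$. Then $\mathcal L$ is not transitive if and only if $(L_1,L_2)$ is not of the form $(E7_0)$, that is, if and only if there are no $x,y\in\mathbb C$ with $xy\neq0$ and $$L_1=\begin{bmatrix}1&0&0\\ x&0&0\\ y&0&0\end{bmatrix},\qquad L_2=\begin{bmatrix}0&1&0\\ b_\Delta(3)x&x&0\\ b_\Delta(2)y&y&0\end{bmatrix}.$$
   Context: $M_3[\mathbb C]$ is the space of $3\times3$ complex matrices and $\mathcal M_3$ its subspace of matrices whose third column is zero. $J=\begin{bmatrix}0&0&0\\ 1&0&0\\ 0&1&0\end{bmatrix}$ and $\Gamma_\Delta(X)=\Delta X-XJ$. A subspace $\mathcal L\subset M_3[\mathbb C]$ is $\Delta$-singular if $\det\Gamma_\Delta(X)=0$ for all $X\in\mathcal L$. It is transitive if $\{Xv:X\in\mathcal L\}=\mathbb C^3$ for every nonzero $v\in\mathbb C^3$. $b_\Delta(2)=\frac1{b_3}-\frac1{b_1}$, $b_\Delta(3)=\frac1{b_2}-\frac1{b_1}$. Canonical basis: order pairs $(i,j)$, $i\in\{1,2,3\}$, $j\in\{1,2\}$, lexicographically ($\prec$). Each 2-dimensional subspace $\mathcal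 L_0\subset\mathcal M_3$ has a unique basis $(L_1,L_2)$, $L_k=[l^k_{i,j}]$, for which there are (unique) pairs $(i_1,j_1)\prec(i_2,j_2)$ with $l^k_{i_r,j_r}=\delta_{k,r}$ for $k,r\in\{1,2\}$ and $l^k_{i,j}=0$ whenever $(i,j)\prec(i_k,j_k)$; it is called the canonical basis of $\mathcal L_0$. *)

theory Defs
  imports "HOL-Analysis.Analysis"
begin

text \<open>The library's unqualified \<open>subspace\<close>, \<open>span\<close> and \<open>dim\<close> on \<open>complex^'n^'m\<close> are the real ones.
  All linear notions on matrices below are over the complex field, through the following
  interpretation.\<close>

definition cmat_scale :: "complex \<Rightarrow> complex^'n^'m \<Rightarrow> complex^'n^'m" where
  "cmat_scale c A = (\<chi> i j. c * A $ i $ j)"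

interpretation cmat: vector_space cmat_scale
  by unfold_locales (simp_all add: cmat_scale_def vec_eq_iff algebra_simps)

definition diag3 :: "complex \<Rightarrow> complex \<Rightarrow> complex \<Rightarrow> complex^3^3" where
  "diag3 b1 b2 b3 = vector [vector [b1, 0, 0], vector [0, b2, 0], vector [0, 0, b3]]"

definition J :: "complex^3^3" where
  "J = vector [vector [0, 0, 0], vector [1, 0, 0], vector [0, 1, 0]]"

definition Gam :: "complex^3^3 \<Rightarrow> complex^3^3 \<Rightarrow> complex^3^3" where
  "Gam \<Delta> X = \<Delta> ** X - X ** J"

definition Delta_singular :: "complex^3^3 \<Rightarrow> (complex^3^3) set \<Rightarrow> bool" where
  "Delta_singular \<Delta> L \<longleftrightarrow> (\<forall>X\<in>L. det (Gam \<Delta> X) = 0)"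

definition transitive_space :: "(complex^3^3) set \<Rightarrow> bool" where
  "transitive_space L \<longleftrightarrow> (\<forall>v. v \<noteq> 0 \<longrightarrow> {X *v v | X. X \<in> L} = UNIV)"

definition M3 :: "(complex^3^3) set" where
  "M3 = {X. \<forall>i. X $ i $ 3 = 0}"

definition b_Delta2 :: "complex^3^3 \<Rightarrow> complex" where
  "b_Delta2 \<Delta> = 1 / \<Delta> $ 3 $ 3 - 1 / \<Delta> $ 1 $ 1"

definition b_Delta3 :: "complex^3^3 \<Rightarrow> complex" where
  "b_Delta3 \<Delta> = 1 / \<Delta> $ 2 $ 2 - 1 / \<Delta> $ 1 $ 1"

text \<open>Positions are pairs of natural numbers, because in the index type \<open>3\<close> the
  numeral 3 equals 0 and is the least element.\<close>

definition entry :: "complex^3^3 \<Rightarrow> nat \<times> nat \<Rightarrow> complex" where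
  "entry A p = A $ of_nat (fst p) $ of_nat (snd p)"

definition positions :: "(nat \<times> nat) set" where
  "positions = {1..3} \<times> {1..2}"

definition prec :: "nat \<times> nat \<Rightarrow> nat \<times> nat \<Rightarrow> bool" where
  "prec p q \<longleftrightarrow> (p, q) \<in> less_than <*lex*> less_than"

definition canonical_basis ::
  "(complex^3^3) set \<Rightarrow> complex^3^3 \<Rightarrow> complex^3^3 \<Rightarrow> bool" where
  "canonical_basis L0 L1 L2 \<longleftrightarrow>
     L1 \<noteq> L2 \<and> cmat.independent {L1, L2} \<and> cmat.span {L1, L2} = L0 \<and>
     (\<exists>p1\<in>positions. \<exists>p2\<in>positions. prec p1 p2 \<and>
        entry L1 p1 = 1 \<and> entry L1 p2 = 0 \<and> entry L2 p1 = 0 \<and> entry L2 p2 = 1 \<and>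
        (\<forall>q\<in>positions. prec q p1 \<longrightarrow> entry L1 q = 0) \<and>
        (\<forall>q\<in>positions. prec q p2 \<longrightarrow> entry L2 q = 0))"

definition form_E7_0 :: "complex^3^3 \<Rightarrow> complex^3^3 \<Rightarrow> complex^3^3 \<Rightarrow> bool" where
  "form_E7_0 \<Delta> L1 L2 \<longleftrightarrow>
     (\<exists>x y. x * y \<noteq> 0 \<and>
        L1 = vector [vector [1, 0, 0],
                     vector [x, 0, 0],
                     vector [y, 0, 0]] \<and>
        L2 = vector [vector [0, 1, 0],
                     vector [b_Delta3 \<Delta> * x, x, 0],
                     vector [b_Delta2 \<Delta> * y, y, 0]])"

end

theory Submission
  imports Defs
begin

text \<open>
  For \<open>M = \<Gamma>\<^sub>\<Delta>(X)\<close> with columns \<open>m\<^sub>1, m\<^sub>2, m\<^sub>3\<close>, a dimension count shows that the third column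
  ranges over everything, so \<open>\<Gamma>\<^sub>\<Delta>(\<L>)\<close> consists of the triples \<open>(A k + p, B k + q, k)\<close> with \<open>k\<close>
  arbitrary and \<open>(p, q)\<close> in the two-dimensional space \<open>N\<close> given by \<open>\<L>\<^sub>0\<close>. Singularity, expanded in powers
  of \<open>(p, q)\<close>, says in top degree that every pair in \<open>N\<close> is linearly dependent. Hence either all
  pairs are \<open>(\<alpha> u, \<beta> u)\<close> for one vector \<open>u\<close>, or all are \<open>(s p, t p)\<close> for fixed scalars \<open>s, t\<close>.

  In the second case the linear term forces \<open>s B - t A\<close> to be a scalar \<open>f\<close>, and \<open>(-t, s, -f)\<close> is a
  common kernel vector \<open>w\<close> of \<open>\<Gamma>\<^sub>\<Delta>(\<L>)\<close>. Since the \<open>i\<close>-th entry of \<open>\<Gamma>\<^sub>\<Delta>(X) w\<close> is the \<open>i\<close>-th entry of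
  \<open>X (b\<^sub>i w - J w)\<close>, the space is not transitive.

  In the first case the linear term gives \<open>A k = f\<^sub>1 k\<close> and \<open>B k = f\<^sub>2 k\<close> modulo \<open>u\<close>. If some \<open>u\<^sub>i = 0\<close>,
  then \<open>w = (1, 0, -f\<^sub>1)\<close> kills the \<open>i\<close>-th row and the same argument applies. If no \<open>u\<^sub>i\<close> vanishes,
  which is the form \<open>(E7\<^sub>0)\<close>, then \<open>X v = z\<close> becomes, for each \<open>i\<close>, one equation in \<open>k\<^sub>i\<close> and two
  shared scalars; the coefficient of \<open>k\<^sub>i\<close> is a polynomial in \<open>1/b\<^sub>i\<close> of degree at most two, and at
  its roots the two scalars suffice for interpolation.
\<close>

section \<open>Triple products and linear dependence of vectors\<close>

definition triple :: "complex^3 \<Rightarrow> complex^3 \<Rightarrow> complex^3 \<Rightarrow> complex" where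
  "triple a b c = a$1 * (b$2 * c$3 - b$3 * c$2) + a$2 * (b$3 * c$1 - b$1 * c$3)
     + a$3 * (b$1 * c$2 - b$2 * c$1)"

lemma det_eq_triple: "det M = triple (column 1 M) (column 2 M) (column 3 M)"
  by (simp add: det_3 triple_def column_def algebra_simps)

text \<open>The triple product is a quadratic polynomial in \<open>t\<close>; its vanishing at 0, 1
  and -1 already kills all three coefficients.\<close>

lemma triple_pencil_coeffs:
  assumes "\<And>t. triple (a + t *s p) (b + t *s q) k = 0"
  shows "triple p q k = 0" and "triple p b k + triple a q k = 0"
proof -
  have e: "triple (a + t *s p) (b + t *s q) k
      = triple a b k + t * (triple p b k + triple a q k) + t^2 * triple p q k" for t
    by (simp add: triple_def algebra_simps power2_eq_square)
  have "triple a b k = 0" using assms[of 0] e[of 0] by simp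
  then have "triple p b k + triple a q k + triple p q k = 0"
    "- triple p b k - triple a q k + triple p q k = 0"
    using assms[of 1] e[of 1] assms[of "-1"] e[of "-1"] by simp_all
  then show "triple p q k = 0" "triple p b k + triple a q k = 0" by algebra+
qed

lemma vec3_eq_0_iff: "v = (0::complex^3) \<longleftrightarrow> v$1 = 0 \<and> v$2 = 0 \<and> v$3 = 0"
  by (simp add: vec_eq_iff forall_3)

text \<open>With the unit vectors for \<open>k\<close>, the hypothesis becomes the vanishing of the
  three 2x2 minors of the pair.\<close>

lemma triple_eq_0_imp_multiple:
  assumes "\<And>k. triple p q k = 0" and "p \<noteq> 0"
  shows "\<exists>c. q = c *s p"
proof -
  have m: "p$1 * q$2 = p$2 * q$1" "p$1 * q$3 = p$3 * q$1" "p$2 * q$3 = p$3 * q$2"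
    using assms(1)[of "axis 1 1"] assms(1)[of "axis 2 1"] assms(1)[of "axis 3 1"]
    by (simp_all add: triple_def axis_def algebra_simps)
  obtain i where i: "p$i \<noteq> 0" using assms(2) by (auto simp: vec_eq_iff)
  have "p$i * q$j = p$j * q$i" for j
    using m exhaust_3[of i] exhaust_3[of j] by (auto simp: algebra_simps)
  then have "q = (q$i / p$i) *s p" using i
    by (simp add: vec_eq_iff field_simps)
  then show ?thesis by blast
qed

text \<open>Degenerate pairs are included: if \<open>p\<close> is zero, \<open>u\<close> can be
  \<open>q\<close> or, when that vanishes too, a unit vector.\<close>

lemma triple_eq_0_imp_rank_one:
  assumes "\<And>k. triple p q k = 0"
  shows "\<exists>u s t. u \<noteq> 0 \<and> p = s *s u \<and> q = t *s u"
proof (cases "p = 0")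
  case True
  show ?thesis
  proof (cases "q = 0")
    case q0: True
    have "(axis 1 1 :: complex^3) \<noteq> 0" by (simp add: axis_eq_0_iff)
    then show ?thesis using True q0 by (metis vec.scale_zero_left)
  next
    case False
    then show ?thesis using True by (metis vec.scale_zero_left vec.scale_one)
  qed
next
  case False
  then show ?thesis using triple_eq_0_imp_multiple[OF assms] by (metis vec.scale_one)
qed

section \<open>Matrices that act as a scalar modulo a vector\<close>

text \<open>A quadratic form in \<open>x\<close>, \<open>y\<close>, \<open>z\<close> vanishes, hence
  so do its six coefficients: unit vectors give the squares, sums of two of them the mixed terms.
  Bare coordinates allow the indices to be permuted later.\<close>

lemma scalar_plus_rank_one_aux:
  fixes u1 u2 u3 :: complex
  assumes u: "u1 \<noteq> 0"
    and z: "\<And>x y z. u1 * ((d21*x+d22*y+d23*z) * z - (d31*x+d32*y+d33*z) * y)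
      + u2 * ((d31*x+d32*y+d33*z) * x - (d11*x+d12*y+d13*z) * z)
      + u3 * ((d11*x+d12*y+d13*z) * y - (d21*x+d22*y+d23*z) * x) = 0"
  shows "\<exists>f g1 g2 g3. d11 = f + u1*g1 \<and> d12 = u1*g2 \<and> d13 = u1*g3
      \<and> d21 = u2*g1 \<and> d22 = f + u2*g2 \<and> d23 = u2*g3
      \<and> d31 = u3*g1 \<and> d32 = u3*g2 \<and> d33 = f + u3*g3"
proof -
  have e: "u2*d31 = u3*d21" "u1*d32 = u3*d12" "u1*d23 = u2*d13"
    using z[of 1 0 0] z[of 0 1 0] z[of 0 0 1] by (simp_all add: algebra_simps)
  have e': "u1*d31 = u2*d32 + u3*d11 - u3*d22" "u1*d21 = u2*d11 + u3*d23 - u2*d33"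
    "u1*d33 = u1*d22 - u2*d12 + u3*d13"
    using z[of 1 1 0] z[of 1 0 1] z[of 0 1 1] e by (simp_all add: algebra_simps)
  \<comment> \<open>These values are forced by the first row and the entry \<open>d22\<close> of the
    desired decomposition.\<close>
  define f where "f = d22 - u2*d12/u1"
  define g1 where "g1 = (d11 - f)/u1"
  define g2 where "g2 = d12/u1"
  define g3 where "g3 = d13/u1"
  have g: "u1*g1 = d11 - f" "u1*g2 = d12" "u1*g3 = d13" "f = d22 - u2*g2"
    using u by (simp_all add: g1_def g2_def g3_def f_def)
  have "u1*d32 = u1*(u3*g2)" "u1*d23 = u1*(u2*g3)" "u1*d33 = u1*(f + u3*g3)"
    "u1*d31 = u1*(u3*g1)" "u1*d21 = u1*(u2*g1)"
    using u e e' g by algebra+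
  then have "d32 = u3*g2" "d23 = u2*g3" "d33 = f + u3*g3" "d31 = u3*g1" "d21 = u2*g1"
    using u by simp_all
  moreover have "d11 = f + u1*g1" "d12 = u1*g2" "d13 = u1*g3" "d22 = f + u2*g2"
    using g by algebra+
  ultimately show ?thesis by blast
qed

text \<open>Modulo the line of \<open>u\<close>, every vector is an eigenvector of \<open>D\<close>,
  so \<open>D\<close> is a scalar \<open>f\<close> there; \<open>g\<close> records the component
  along \<open>u\<close>.\<close>

lemma scalar_plus_rank_one:
  assumes u: "u \<noteq> 0" and z: "\<And>k. triple u (D *v k) k = 0"
  shows "\<exists>f (g::complex^3). \<forall>k. D *v k = f *s k + (g$1 * k$1 + g$2 * k$2 + g$3 * k$3) *s u"
proof -
  let ?d = "\<lambda>i j. D$i$j"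
  have mv: "(D *v k)$i = ?d i 1 * k$1 + ?d i 2 * k$2 + ?d i 3 * k$3" for k i
    by (simp add: matrix_vector_mult_def sum_3)
  have z': "u$1 * ((?d 2 1*x+?d 2 2*y+?d 2 3*z) * z - (?d 3 1*x+?d 3 2*y+?d 3 3*z) * y)
      + u$2 * ((?d 3 1*x+?d 3 2*y+?d 3 3*z) * x - (?d 1 1*x+?d 1 2*y+?d 1 3*z) * z)
      + u$3 * ((?d 1 1*x+?d 1 2*y+?d 1 3*z) * y - (?d 2 1*x+?d 2 2*y+?d 2 3*z) * x) = 0" for x y z
    using z[of "vector [x,y,z]"] by (simp add: triple_def mv)
  have "u$1 \<noteq> 0 \<or> u$2 \<noteq> 0 \<or> u$3 \<noteq> 0" using u by (simp add: vec3_eq_0_iff)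
  then have "\<exists>f g1 g2 g3. ?d 1 1 = f + u$1*g1 \<and> ?d 1 2 = u$1*g2 \<and> ?d 1 3 = u$1*g3
      \<and> ?d 2 1 = u$2*g1 \<and> ?d 2 2 = f + u$2*g2 \<and> ?d 2 3 = u$2*g3
      \<and> ?d 3 1 = u$3*g1 \<and> ?d 3 2 = u$3*g2 \<and> ?d 3 3 = f + u$3*g3"
  proof (elim disjE)
    assume "u$1 \<noteq> 0"
    from scalar_plus_rank_one_aux[OF this z'] show ?thesis .
  next
    \<comment> \<open>The triple product is invariant under cyclic permutation of the coordinates,
      which reduces this case and the next to the first.\<close>
    assume a: "u$2 \<noteq> 0"
    have "\<exists>f g1 g2 g3. ?d 2 2 = f + u$2*g1 \<and> ?d 2 3 = u$2*g2 \<and> ?d 2 1 = u$2*g3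
      \<and> ?d 3 2 = u$3*g1 \<and> ?d 3 3 = f + u$3*g2 \<and> ?d 3 1 = u$3*g3
      \<and> ?d 1 2 = u$1*g1 \<and> ?d 1 3 = u$1*g2 \<and> ?d 1 1 = f + u$1*g3"
      apply (rule scalar_plus_rank_one_aux[OF a])
      subgoal for x y z using z'[of z x y] by (simp add: algebra_simps)
      done
    then show ?thesis by blast
  next
    assume a: "u$3 \<noteq> 0"
    have "\<exists>f g1 g2 g3. ?d 3 3 = f + u$3*g1 \<and> ?d 3 1 = u$3*g2 \<and> ?d 3 2 = u$3*g3
      \<and> ?d 1 3 = u$1*g1 \<and> ?d 1 1 = f + u$1*g2 \<and> ?d 1 2 = u$1*g3
      \<and> ?d 2 3 = u$2*g1 \<and> ?d 2 1 = u$2*g2 \<and> ?d 2 2 = f + u$2*g3"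
      apply (rule scalar_plus_rank_one_aux[OF a])
      subgoal for x y z using z'[of y z x] by (simp add: algebra_simps)
      done
    then show ?thesis by blast
  qed
  then obtain f g1 g2 g3 where "?d 1 1 = f + u$1*g1 \<and> ?d 1 2 = u$1*g2 \<and> ?d 1 3 = u$1*g3
      \<and> ?d 2 1 = u$2*g1 \<and> ?d 2 2 = f + u$2*g2 \<and> ?d 2 3 = u$2*g3
      \<and> ?d 3 1 = u$3*g1 \<and> ?d 3 2 = u$3*g2 \<and> ?d 3 3 = f + u$3*g3" by blast
  then have "\<forall>k. D *v k = f *s k + ((vector [g1,g2,g3]::complex^3)$1 * k$1 + (vector [g1,g2,g3]::complex^3)$2 * k$2
      + (vector [g1,g2,g3]::complex^3)$3 * k$3) *s u"
    by (simp add: vec_eq_iff forall_3 mv algebra_simps)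
  then show ?thesis by blast
qed

text \<open>The first condition leaves a scalar plus a functional \<open>G\<close> along
  \<open>p\<close>. The second makes the product of \<open>G\<close> and the nonzero linear form
  \<open>triple p p'\<close> vanish, so \<open>G\<close> is zero.\<close>

lemma scalar_if_two_triples:
  assumes p: "p \<noteq> 0" and p': "\<nexists>c. p' = c *s p"
    and z: "\<And>k. triple p (D *v k) k = 0" and z': "\<And>k. triple p' (D *v k) k = 0"
  shows "\<exists>f. \<forall>k. D *v k = f *s k"
proof -
  obtain f and g :: "complex^3" where D: "\<And>k. D *v k = f *s k + (g$1 * k$1 + g$2 * k$2 + g$3 * k$3) *s p"
    using scalar_plus_rank_one[OF p z] by blast
  define G where "G k = g$1 * k$1 + g$2 * k$2 + g$3 * k$3" for k :: "complex^3"
  have prod0: "G k * triple p p' k = 0" for k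
    using z'[of k] unfolding D G_def[symmetric] by (simp add: triple_def algebra_simps)
  obtain y where y: "triple p p' y \<noteq> 0"
    using triple_eq_0_imp_multiple[OF _ p] p' by blast
  \<comment> \<open>If neither linear form were zero, their product would not vanish at the sum of a
    point where one is nonzero and a point where the other is.\<close>
  have "G k = 0" for k
  proof (rule ccontr)
    assume k: "G k \<noteq> 0"
    have "G y = 0" "triple p p' k = 0" using prod0[of y] y prod0[of k] k by auto
    moreover have "G (k + y) = G k + G y" "triple p p' (k + y) = triple p p' k + triple p p' y"
      by (simp_all add: G_def triple_def algebra_simps)
    ultimately show False using prod0[of "k + y"] k y by simp
  qed
  then show ?thesis using D unfolding G_def by simp
qed

section \<open>The operator \<open>Gam\<close> and the shape of its image\<close>

text \<open>Right multiplication by \<open>J\<close> shifts the columns to the left and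
  \<open>\<Delta>\<close> scales the rows, so each row is transformed on its own.\<close>

lemma Gam_diag3:
  assumes "\<Delta> = diag3 b1 b2 b3"
  shows "Gam \<Delta> X $ i $ 1 = \<Delta>$i$i * X$i$1 - X$i$2"
    and "Gam \<Delta> X $ i $ 2 = \<Delta>$i$i * X$i$2 - X$i$3"
    and "Gam \<Delta> X $ i $ 3 = \<Delta>$i$i * X$i$3"
  using exhaust_3[of i]
  by (auto simp: assms Gam_def diag3_def J_def matrix_matrix_mult_def sum_3)

lemma Gam_add: "Gam \<Delta> (X + Y) = Gam \<Delta> X + Gam \<Delta> Y"
  by (simp add: Gam_def matrix_matrix_mult_def vec_eq_iff sum.distrib algebra_simps)

lemma Gam_cmat_scale: "Gam \<Delta> (cmat_scale c X) = cmat_scale c (Gam \<Delta> X)"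
  by (simp add: Gam_def cmat_scale_def matrix_matrix_mult_def vec_eq_iff sum_distrib_left
      algebra_simps)

lemma column_add: "column j (X + Y) = column j X + column j Y"
  by (simp add: column_def vec_eq_iff)

lemma column_cmat_scale: "column j (cmat_scale c X) = c *s column j X"
  by (simp add: column_def cmat_scale_def vec_eq_iff)

lemma span_pair_cmat:
  assumes "X \<in> cmat.span {Y, Z}"
  shows "\<exists>\<alpha> \<beta>. X = cmat_scale \<alpha> Y + cmat_scale \<beta> Z"
proof -
  obtain \<alpha> where "X - cmat_scale \<alpha> Y \<in> cmat.span {Z}"
    using assms cmat.span_insert[of Y "{Z}"] by auto
  then obtain \<beta> where "X - cmat_scale \<alpha> Y = cmat_scale \<beta> Z"
    using cmat.span_singleton[of Z] by auto
  then show ?thesis by (metis add.commute diff_add_cancel)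
qed

text \<open>The third-column map on \<open>L\<close> has the two-dimensional kernel
  \<open>L \<inter> M3\<close>, hence rank 3. Concretely, \<open>L1\<close>, \<open>L2\<close> are
  completed to a basis by three matrices, whose third columns form an injective square
  matrix.\<close>

lemma third_column_surj:
  assumes L: "cmat.subspace L" "cmat.dim L = 5"
    and L12: "L1 \<noteq> L2" "cmat.independent {L1, L2}" "cmat.span {L1, L2} = L \<inter> M3"
  shows "\<exists>X\<in>L. column 3 X = k"
proof -
  have sub: "{L1, L2} \<subseteq> L" using L12(3) cmat.span_superset[of "{L1,L2}"] by blast
  obtain E where E: "{L1, L2} \<subseteq> E" "E \<subseteq> L" "cmat.independent E" "L \<subseteq> cmat.span E"
    using cmat.maximal_independent_subset_extend[OF sub L12(2)] by blast
  have "card E = 5" using cmat.basis_card_eq_dim[OF E(2,4,3)] L(2) by simp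
  then have "card (E - {L1, L2}) = 3"
    using E(1) L12(1) by (simp add: card_Diff_subset)
  then obtain X Y Z where XYZ: "E - {L1, L2} = {X, Y, Z}" "X \<noteq> Y" "Y \<noteq> Z" "X \<noteq> Z"
    by (auto simp: card_3_iff)
  have XYZL: "X \<in> L" "Y \<in> L" "Z \<in> L" using XYZ E(2) by blast+
  define comb where
    "comb a = cmat_scale (a$1) X + cmat_scale (a$2) Y + cmat_scale (a$3) Z" for a :: "complex^3"
  have combL: "comb a \<in> L" for a
    using XYZL L(1) by (simp add: comb_def cmat.subspace_add cmat.subspace_scale)
  define C :: "complex^3^3" where "C = (\<chi> i. vector [X$i$3, Y$i$3, Z$i$3])"
  have C: "C *v a = column 3 (comb a)" for a
    by (simp add: C_def comb_def column_def matrix_vector_mult_def sum_3 vec_eq_iff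
        cmat_scale_def mult.commute)
  have in_span: "W \<in> cmat.span (E - {V})" if "W \<in> E" "W \<noteq> V" for V W
    using that by (simp add: cmat.span_base)
  have not_span: "V \<notin> cmat.span (E - {V})" if "V \<in> E" for V
    using E(3) that by (auto simp: cmat.dependent_def)
  \<comment> \<open>Otherwise dividing by \<open>c\<close> would express the basis element
    \<open>V\<close> through the rest of the basis.\<close>
  have solve: "c = 0" if V: "V \<in> {X, Y, Z}" and W: "\<And>T. T \<in> {X,Y,Z} \<Longrightarrow> T \<noteq> V \<Longrightarrow> T \<in> {W1, W2}"
      and W12: "W1 \<in> {X,Y,Z} - {V}" "W2 \<in> {X,Y,Z} - {V}"
      and eq: "cmat_scale c V + cmat_scale c1 W1 + cmat_scale c2 W2 = U" and U: "U \<in> cmat.span {L1, L2}"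
    for c c1 c2 V W1 W2 U
  proof (rule ccontr)
    assume c: "c \<noteq> 0"
    let ?S = "cmat.span (E - {V})"
    have "{L1, L2} \<subseteq> E - {V}" using E(1) V XYZ(1) by blast
    then have "U \<in> ?S" using U cmat.span_mono by blast
    moreover have "W1 \<in> ?S" "W2 \<in> ?S" using W12 XYZ(1) by (auto intro!: in_span)
    ultimately have "U - cmat_scale c1 W1 - cmat_scale c2 W2 \<in> ?S"
      by (intro cmat.span_diff cmat.span_scale)
    moreover have "U - cmat_scale c1 W1 - cmat_scale c2 W2 = cmat_scale c V"
      using eq by (simp add: algebra_simps)
    ultimately have "cmat_scale (1/c) (cmat_scale c V) \<in> ?S"
      using cmat.span_scale by metis
    then have "V \<in> ?S" using c by simp
    then show False using not_span V XYZ(1) by blast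
  qed
  have ker: "a = 0" if "C *v a = 0" for a
  proof -
    have "comb a \<in> M3" using that unfolding C
      by (simp add: M3_def column_def vec_eq_iff)
    then have U: "comb a \<in> cmat.span {L1, L2}" using combL L12(3) by blast
    have "a$1 = 0" by (rule solve[of X Y Z _ "a$2" "a$3", OF _ _ _ _ _ U]) (use XYZ in \<open>auto simp: comb_def\<close>)
    moreover have "a$2 = 0" by (rule solve[of Y X Z _ "a$1" "a$3", OF _ _ _ _ _ U]) (use XYZ in \<open>auto simp: comb_def\<close>)
    moreover have "a$3 = 0" by (rule solve[of Z X Y _ "a$1" "a$2", OF _ _ _ _ _ U]) (use XYZ in \<open>auto simp: comb_def\<close>)
    ultimately show ?thesis by (simp add: vec3_eq_0_iff)
  qed
  then have "surj ((*v) C)"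
    using matrix_left_invertible_ker[of C] matrix_left_right_inverse
      matrix_right_invertible_surjective by blast
  then obtain a where "k = C *v a" by (metis surjD)
  then show ?thesis using C combL by metis
qed

text \<open>\<open>A\<close> and \<open>B\<close> come from a linear section of the third column of
  \<open>Gam \<Delta> X\<close>; elements of \<open>L\<close> with the same third column there
  differ by an element of \<open>L \<inter> M3\<close>.\<close>

lemma Gam_parametrization:
  assumes \<Delta>: "\<Delta> = diag3 b1 b2 b3" and b: "b1 \<noteq> 0" "b2 \<noteq> 0" "b3 \<noteq> 0"
    and L: "cmat.subspace L" and surj: "\<And>k. \<exists>X\<in>L. column 3 X = k"
    and L12: "cmat.span {L1, L2} = L \<inter> M3"
  obtains A B :: "complex^3^3" where
    "\<And>X. X \<in> L \<Longrightarrow> \<exists>\<alpha> \<beta>.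
       column 1 (Gam \<Delta> X) = A *v column 3 (Gam \<Delta> X)
          + \<alpha> *s column 1 (Gam \<Delta> L1) + \<beta> *s column 1 (Gam \<Delta> L2) \<and>
       column 2 (Gam \<Delta> X) = B *v column 3 (Gam \<Delta> X)
          + \<alpha> *s column 2 (Gam \<Delta> L1) + \<beta> *s column 2 (Gam \<Delta> L2)"
    "\<And>k \<alpha> \<beta>. \<exists>X\<in>L. column 3 (Gam \<Delta> X) = k \<and>
       column 1 (Gam \<Delta> X) = A *v k
          + \<alpha> *s column 1 (Gam \<Delta> L1) + \<beta> *s column 1 (Gam \<Delta> L2) \<and>
       column 2 (Gam \<Delta> X) = B *v k
          + \<alpha> *s column 2 (Gam \<Delta> L1) + \<beta> *s column 2 (Gam \<Delta> L2)"
proof -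
  have dne: "\<Delta>$i$i \<noteq> 0" for i
    using b exhaust_3[of i] by (auto simp: \<Delta> diag3_def)
  have "\<exists>X\<in>L. column 3 (Gam \<Delta> X) = k" for k
  proof -
    obtain X where "X \<in> L" "column 3 X = (\<chi> i. k$i / \<Delta>$i$i)" using surj by blast
    then show ?thesis using dne
      by (intro bexI[of _ X]) (simp_all add: vec_eq_iff column_def Gam_diag3[OF \<Delta>])
  qed
  then obtain R where R: "\<And>k. R k \<in> L" "\<And>k. column 3 (Gam \<Delta> (R k)) = k" by metis
  \<comment> \<open>\<open>R\<close> is an arbitrary choice; using it only at the unit vectors makes
    the section linear.\<close>
  define E where "E k = cmat_scale (k$1) (R (axis 1 1)) + cmat_scale (k$2) (R (axis 2 1))
    + cmat_scale (k$3) (R (axis 3 1))" for k :: "complex^3"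
  define A :: "complex^3^3" where "A = (\<chi> i j. Gam \<Delta> (R (axis j 1)) $ i $ 1)"
  define B :: "complex^3^3" where "B = (\<chi> i j. Gam \<Delta> (R (axis j 1)) $ i $ 2)"
  have EL: "E k \<in> L" for k
    using R(1) L by (simp add: E_def cmat.subspace_add cmat.subspace_scale)
  have E3: "column 3 (Gam \<Delta> (E k)) = k" for k
    unfolding E_def Gam_add Gam_cmat_scale column_add column_cmat_scale R(2)
    by (simp add: vec_eq_iff forall_3 axis_def)
  have E1: "column 1 (Gam \<Delta> (E k)) = A *v k" and E2: "column 2 (Gam \<Delta> (E k)) = B *v k" for k
    unfolding E_def Gam_add Gam_cmat_scale column_add column_cmat_scale
    by (simp_all add: A_def B_def vec_eq_iff column_def matrix_vector_mult_def sum_3 mult.commute)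
  have L12L: "cmat_scale \<alpha> L1 + cmat_scale \<beta> L2 \<in> L \<inter> M3" for \<alpha> \<beta>
    unfolding L12[symmetric] by (intro cmat.span_add cmat.span_scale cmat.span_base) auto
  have c3: "column 3 (Gam \<Delta> Y) = 0 \<longleftrightarrow> Y \<in> M3" for Y
    using dne by (simp add: M3_def vec_eq_iff column_def Gam_diag3[OF \<Delta>])
  show ?thesis
  proof (rule that)
    fix X assume X: "X \<in> L"
    define k where "k = column 3 (Gam \<Delta> X)"
    define Y where "Y = X + cmat_scale (-1) (E k)"
    have "Y \<in> L" using X EL L unfolding Y_def by (intro cmat.subspace_add cmat.subspace_scale)
    moreover have "column 3 (Gam \<Delta> Y) = 0"
      unfolding Y_def Gam_add Gam_cmat_scale column_add column_cmat_scale E3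
      by (simp add: k_def vec_eq_iff)
    ultimately have "Y \<in> cmat.span {L1, L2}" using c3 L12 by simp
    then obtain \<alpha> \<beta> where "Y = cmat_scale \<alpha> L1 + cmat_scale \<beta> L2"
      using span_pair_cmat by blast
    moreover have "X = E k + Y" by (simp add: Y_def cmat_scale_def vec_eq_iff)
    ultimately have X': "X = E k + (cmat_scale \<alpha> L1 + cmat_scale \<beta> L2)" by simp
    have "column 1 (Gam \<Delta> X) = A *v k
          + \<alpha> *s column 1 (Gam \<Delta> L1) + \<beta> *s column 1 (Gam \<Delta> L2) \<and>
       column 2 (Gam \<Delta> X) = B *v k
          + \<alpha> *s column 2 (Gam \<Delta> L1) + \<beta> *s column 2 (Gam \<Delta> L2)"
      by (simp add: X' Gam_add Gam_cmat_scale column_add column_cmat_scale E1 E2)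
    then show "\<exists>\<alpha> \<beta>. column 1 (Gam \<Delta> X) = A *v column 3 (Gam \<Delta> X)
          + \<alpha> *s column 1 (Gam \<Delta> L1) + \<beta> *s column 1 (Gam \<Delta> L2) \<and>
       column 2 (Gam \<Delta> X) = B *v column 3 (Gam \<Delta> X)
          + \<alpha> *s column 2 (Gam \<Delta> L1) + \<beta> *s column 2 (Gam \<Delta> L2)"
      unfolding k_def by blast
  next
    fix k \<alpha> \<beta>
    let ?Y = "cmat_scale \<alpha> L1 + cmat_scale \<beta> L2"
    let ?X = "E k + ?Y"
    have Y3: "column 3 (Gam \<Delta> ?Y) = 0" using L12L c3 by blast
    have "?X \<in> L" using cmat.subspace_add[OF L EL] L12L by blast
    moreover have "column 3 (Gam \<Delta> ?X) = k"
      unfolding Gam_add[of _ "E k"] column_add[of _ "Gam \<Delta> (E k)"] Y3 E3 by simp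
    moreover have "column 1 (Gam \<Delta> ?X) = A *v k
          + \<alpha> *s column 1 (Gam \<Delta> L1) + \<beta> *s column 1 (Gam \<Delta> L2)"
       "column 2 (Gam \<Delta> ?X) = B *v k
          + \<alpha> *s column 2 (Gam \<Delta> L1) + \<beta> *s column 2 (Gam \<Delta> L2)"
      by (simp_all add: Gam_add Gam_cmat_scale column_add column_cmat_scale E1 E2)
    ultimately show "\<exists>X\<in>L. column 3 (Gam \<Delta> X) = k \<and>
       column 1 (Gam \<Delta> X) = A *v k
          + \<alpha> *s column 1 (Gam \<Delta> L1) + \<beta> *s column 1 (Gam \<Delta> L2) \<and>
       column 2 (Gam \<Delta> X) = B *v k
          + \<alpha> *s column 2 (Gam \<Delta> L1) + \<beta> *s column 2 (Gam \<Delta> L2)" by blast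
  qed
qed

section \<open>Criteria for and against transitivity\<close>

lemma not_transitive_if_Gam_row_kernel:
  assumes \<Delta>: "\<Delta> = diag3 b1 b2 b3" and b: "b1 \<noteq> 0" "b2 \<noteq> 0" "b3 \<noteq> 0"
    and w: "w \<noteq> 0" and z: "\<And>X. X \<in> L \<Longrightarrow> (Gam \<Delta> X *v w) $ i = 0"
  shows "\<not> transitive_space L"
proof
  assume tr: "transitive_space L"
  define d where "d = \<Delta>$i$i"
  have d: "d \<noteq> 0" using b exhaust_3[of i] by (auto simp: d_def \<Delta> diag3_def)
  \<comment> \<open>This is \<open>d *s w - J *v w\<close>, the image of \<open>w\<close> under a
    triangular matrix with diagonal entries \<open>d\<close>, hence nonzero.\<close>
  define v :: "complex^3" where "v = vector [d * w$1, d * w$2 - w$1, d * w$3 - w$2]"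
  have "v \<noteq> 0" using w d by (auto simp: v_def vec3_eq_0_iff)
  then obtain X where X: "X \<in> L" "X *v v = axis i 1"
    using tr unfolding transitive_space_def by (smt (verit) UNIV_I mem_Collect_eq)
  have "(X *v v) $ i = (Gam \<Delta> X *v w) $ i"
    by (simp add: v_def d_def matrix_vector_mult_def sum_3 Gam_diag3[OF \<Delta>] algebra_simps)
  then show False using z[OF X(1)] X(2) by (simp add: axis_def)
qed

text \<open>As a function of the node, the left side is affine with slope
  \<open>\<beta> * v1\<close>, and \<open>\<alpha>\<close> adjusts its constant term.\<close>

lemma affine_through_two_points:
  fixes v1 v2 r s y z :: complex
  assumes "v1 \<noteq> 0" and "r \<noteq> s"
  shows "\<exists>\<alpha> \<beta>. \<alpha> * v1 + \<beta> * (v2 + v1 * r) = y \<and> \<alpha> * v1 + \<beta> * (v2 + v1 * s) = z"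
proof -
  define \<beta> where "\<beta> = (y - z) / (v1 * (r - s))"
  define \<alpha> where "\<alpha> = (y - \<beta> * (v2 + v1 * r)) / v1"
  have "\<beta> * (v1 * (r - s)) = y - z" "\<alpha> * v1 = y - \<beta> * (v2 + v1 * r)"
    using assms by (simp_all add: \<beta>_def \<alpha>_def)
  then have "\<alpha> * v1 + \<beta> * (v2 + v1 * r) = y" "\<alpha> * v1 + \<beta> * (v2 + v1 * s) = z" by algebra+
  then show ?thesis by blast
qed

text \<open>\<open>p\<close> samples a polynomial with leading coefficient \<open>v$1\<close> at
  distinct nodes. If \<open>v$1\<close> is nonzero, at most two nodes are roots and an affine
  function suffices. If it is zero, the left side is the constant \<open>\<beta> * v$2\<close>, and
  there is at most one root, or none when \<open>v$2\<close> vanishes as well.\<close>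

lemma interpolate_at_roots:
  fixes r y p :: "3 \<Rightarrow> complex" and v :: "complex^3"
  assumes v: "v \<noteq> 0" and r: "inj r"
    and p: "\<And>i. p i = v$3 + f2 * v$2 + f1 * v$1 + r i * (v$2 + f2 * v$1) + (r i)^2 * v$1"
  shows "\<exists>\<alpha> \<beta>. \<forall>i. p i = 0 \<longrightarrow> \<alpha> * v$1 + \<beta> * (v$2 + v$1 * r i) = y i"
proof -
  have r: "r 1 \<noteq> r 2" "r 1 \<noteq> r 3" "r 2 \<noteq> r 3" using r by (simp_all add: inj_eq)
  show ?thesis
  proof (cases "v$1 = 0")
    case False
    note aff = affine_through_two_points[OF False]
    \<comment> \<open>Second divided differences of three zero values would leave
      \<open>v$1 = 0\<close>.\<close>
    have "p 1 \<noteq> 0 \<or> p 2 \<noteq> 0 \<or> p 3 \<noteq> 0"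
    proof (rule ccontr)
      assume "\<not> ?thesis"
      then have "p 1 - p 2 = 0" "p 1 - p 3 = 0" by auto
      then have "(r 1 - r 2) * (v$2 + f2 * v$1 + (r 1 + r 2) * v$1) = 0"
        "(r 1 - r 3) * (v$2 + f2 * v$1 + (r 1 + r 3) * v$1) = 0"
        unfolding p by algebra+
      then have "v$2 + f2 * v$1 + (r 1 + r 2) * v$1 = 0" "v$2 + f2 * v$1 + (r 1 + r 3) * v$1 = 0"
        using r by auto
      then have "(r 2 - r 3) * v$1 = 0" by algebra
      then show False using r False by simp
    qed
    then show ?thesis
      using aff[OF r(1), of "v$2" "y 1" "y 2"] aff[OF r(2), of "v$2" "y 1" "y 3"]
        aff[OF r(3), of "v$2" "y 2" "y 3"] unfolding forall_3 by metis
  next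
    case v1: True
    show ?thesis
    proof (cases "v$2 = 0")
      case True
      then have "p i \<noteq> 0" for i using v1 v p[of i] by (auto simp: vec3_eq_0_iff)
      then show ?thesis by simp
    next
      case False
      show ?thesis
      proof (cases "\<exists>i. p i = 0")
        case True
        then obtain i where i: "p i = 0" by blast
        have "j = i" if "p j = 0" for j
        proof -
          have "(r j - r i) * v$2 = 0" using p[of i] p[of j] that i v1 by algebra
          then show ?thesis using False assms(2) by (simp add: inj_eq)
        qed
        then show ?thesis using False v1
          by (intro exI[of _ 0] exI[of _ "y i / v$2"]) auto
      qed auto
    qed
  qed
qed

text \<open>Solving each row backwards shows that \<open>k$i\<close> enters
  \<open>(X *v v)$i\<close> with coefficient \<open>r i * p i\<close>. The shared
  \<open>\<alpha>\<close> and \<open>\<beta>\<close> settle the rows where \<open>p i = 0\<close>;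
  \<open>k$i\<close> settles the others.\<close>

lemma transitive_if_rank_one_pencil:
  assumes \<Delta>: "\<Delta> = diag3 b1 b2 b3" and b: "b1 \<noteq> 0" "b2 \<noteq> 0" "b3 \<noteq> 0" "distinct [b1, b2, b3]"
    and u: "\<And>i. u$i \<noteq> 0"
    and L: "\<And>k \<alpha> \<beta>. \<exists>X\<in>L. column 3 (Gam \<Delta> X) = k \<and>
       column 1 (Gam \<Delta> X) = f1 *s k + \<alpha> *s u \<and> column 2 (Gam \<Delta> X) = f2 *s k + \<beta> *s u"
  shows "transitive_space L"
  unfolding transitive_space_def
proof (intro allI impI equalityI subset_UNIV subsetI)
  fix v z :: "complex^3" assume v: "v \<noteq> 0"
  define r where "r i = 1 / \<Delta>$i$i" for i
  have r0: "r i \<noteq> 0" and dr: "\<Delta>$i$i * c = e \<longleftrightarrow> c = r i * e" for i c e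
    using b exhaust_3[of i] by (auto simp: r_def \<Delta> diag3_def field_simps)
  have rinj: "inj r" unfolding inj_on_def
    using b exhaust_3 by (auto simp: r_def \<Delta> diag3_def forall_3)
  define p where "p i = v$3 + f2 * v$2 + f1 * v$1 + r i * (v$2 + f2 * v$1) + (r i)^2 * v$1" for i
  obtain \<alpha> \<beta> where ab: "\<And>i. p i = 0 \<Longrightarrow> \<alpha> * v$1 + \<beta> * (v$2 + v$1 * r i) = z$i / (r i * u$i)"
    using interpolate_at_roots[OF v rinj p_def, where y = "\<lambda>i. z$i / (r i * u$i)"] by blast
  \<comment> \<open>At a root of \<open>p\<close> the quotient takes the default value 0, which is
    harmless since \<open>k$i\<close> is then multiplied by zero.\<close>
  define k :: "complex^3" where
    "k = (\<chi> i. (z$i / r i - (\<alpha> * v$1 + \<beta> * (v$2 + v$1 * r i)) * u$i) / p i)"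
  have k: "k$i * p i + (\<alpha> * v$1 + \<beta> * (v$2 + v$1 * r i)) * u$i = z$i / r i" for i
    using ab[of i] u[of i] r0[of i] by (cases "p i = 0") (simp_all add: k_def)
  obtain X where X: "X \<in> L" "column 3 (Gam \<Delta> X) = k"
       "column 1 (Gam \<Delta> X) = f1 *s k + \<alpha> *s u" "column 2 (Gam \<Delta> X) = f2 *s k + \<beta> *s u"
    using L by blast
  have "\<Delta>$i$i * X$i$3 = k$i"
    "\<Delta>$i$i * X$i$2 = f2 * k$i + \<beta> * u$i + X$i$3"
    "\<Delta>$i$i * X$i$1 = f1 * k$i + \<alpha> * u$i + X$i$2" for i
    using X(2-4) by (simp_all add: vec_eq_iff column_def Gam_diag3[OF \<Delta>] algebra_simps)
  then have e: "X$i$3 = r i * k$i" "X$i$2 = r i * (f2 * k$i + \<beta> * u$i + X$i$3)"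
    "X$i$1 = r i * (f1 * k$i + \<alpha> * u$i + X$i$2)" for i unfolding dr by blast+
  have "(X *v v)$i = z$i" for i
  proof -
    have "(X *v v)$i = X$i$1 * v$1 + X$i$2 * v$2 + X$i$3 * v$3"
      by (simp add: matrix_vector_mult_def sum_3)
    also have "\<dots> = r i * (k$i * p i + (\<alpha> * v$1 + \<beta> * (v$2 + v$1 * r i)) * u$i)"
      unfolding e(3) e(2) e(1) p_def by algebra
    also have "\<dots> = z$i" unfolding k using r0[of i] by simp
    finally show ?thesis .
  qed
  then have "z = X *v v" by (simp add: vec_eq_iff)
  then show "z \<in> {X *v v |X. X \<in> L}" using X(1) by blast
qed

section \<open>Two-dimensional spaces of pairs of rank at most one\<close>

text \<open>Each generator is a vector times a coefficient pair \<open>(s, t)\<close>. Independent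
  coefficient pairs force parallel vectors; proportional ones can be made equal by rescaling a
  vector.\<close>

lemma rank_one_pencil_cases:
  fixes p1 p2 q1 q2 :: "complex^3"
  assumes z: "\<And>\<alpha> \<beta> k. triple (\<alpha> *s p1 + \<beta> *s p2) (\<alpha> *s q1 + \<beta> *s q2) k = 0"
    and ind: "\<And>\<alpha> \<beta>. \<alpha> *s p1 + \<beta> *s p2 = 0 \<Longrightarrow> \<alpha> *s q1 + \<beta> *s q2 = 0 \<Longrightarrow> \<alpha> = 0 \<and> \<beta> = 0"
  obtains (image) u s1 t1 s2 t2 where "u \<noteq> 0" "p1 = s1 *s u" "q1 = t1 *s u"
      "p2 = s2 *s u" "q2 = t2 *s u" "s1 * t2 \<noteq> s2 * t1"
    | (kernel) s t u1 u2 where "s \<noteq> 0 \<or> t \<noteq> 0" "u1 \<noteq> 0" "\<nexists>c. u2 = c *s u1"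
      "p1 = s *s u1" "q1 = t *s u1" "p2 = s *s u2" "q2 = t *s u2"
proof -
  have "triple p1 q1 k = 0" "triple p2 q2 k = 0" for k
    using z[of 1 0 k] z[of 0 1 k] by simp_all
  then obtain u1 s1 t1 u2 s2 t2 where
    1: "u1 \<noteq> 0" "p1 = s1 *s u1" "q1 = t1 *s u1" and 2: "u2 \<noteq> 0" "p2 = s2 *s u2" "q2 = t2 *s u2"
    using triple_eq_0_imp_rank_one by metis
  have st1: "s1 \<noteq> 0 \<or> t1 \<noteq> 0" using ind[of 1 0] by (auto simp: 1)
  show ?thesis
  proof (cases "s1 * t2 = s2 * t1")
    case False
    have "(s1 * t2 - s2 * t1) * triple u1 u2 k = 0" for k
      using z[of 1 1 k] by (simp add: 1 2 triple_def algebra_simps)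
    then have "triple u1 u2 k = 0" for k using False by simp
    then obtain c where c: "u2 = c *s u1" using triple_eq_0_imp_multiple 1(1) by blast
    then have "c \<noteq> 0" using 2(1) by auto
    then have "s1 * (t2 * c) \<noteq> s2 * c * t1" using False by auto
    then show ?thesis using 1 2 c image[of u1 s1 t1 "s2 * c" "t2 * c"] by simp
  next
    case True
    obtain c where c: "s2 = s1 * c" "t2 = t1 * c"
    proof (cases "s1 = 0")
      case s: True
      then have "s2 = 0" "t1 \<noteq> 0" using True st1 by auto
      then show ?thesis using s that[of "t2 / t1"] by simp
    next
      case s: False
      then show ?thesis using True that[of "s2 / s1"] by (simp add: field_simps)
    qed
    \<comment> \<open>Parallel vectors would make the second generator a multiple of the first,
      against \<open>ind\<close>.\<close>
    have "\<nexists>d. c *s u2 = d *s u1"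
    proof
      assume "\<exists>d. c *s u2 = d *s u1"
      then obtain d where d: "c *s u2 = d *s u1" by blast
      have "p2 = d *s p1" "q2 = d *s q1"
        unfolding 1 2 c using d by (simp_all add: vec_eq_iff algebra_simps)
      then show False using ind[of "-d" 1] by simp
    qed
    then show ?thesis using 1 2 c st1 kernel[of s1 t1 u1 "c *s u2"] by simp
  qed
qed

section \<open>The form \<open>form_E7_0\<close> as a common image vector without zero
  entries\<close>

lemma M3_entries_of_Gam_columns:
  assumes \<Delta>: "\<Delta> = diag3 b1 b2 b3" and b: "b1 \<noteq> 0" "b2 \<noteq> 0" "b3 \<noteq> 0" and X: "X \<in> M3"
    and c: "column 1 (Gam \<Delta> X) = s *s u" "column 2 (Gam \<Delta> X) = t *s u"
  shows "X$i$3 = 0" and "X$i$2 = t * (u$i / \<Delta>$i$i)"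
    and "X$i$1 = s * (u$i / \<Delta>$i$i) + t * (u$i / \<Delta>$i$i) / \<Delta>$i$i"
proof -
  have d: "\<Delta>$i$i \<noteq> 0" using b exhaust_3[of i] by (auto simp: \<Delta> diag3_def)
  show x3: "X$i$3 = 0" using X by (simp add: M3_def)
  then show x2: "X$i$2 = t * (u$i / \<Delta>$i$i)"
    using c(2) d by (simp add: vec_eq_iff column_def Gam_diag3[OF \<Delta>] field_simps)
  have "\<Delta>$i$i * X$i$1 = s * u$i + X$i$2"
    using c(1) by (simp add: vec_eq_iff column_def Gam_diag3[OF \<Delta>] algebra_simps)
  then show "X$i$1 = s * (u$i / \<Delta>$i$i) + t * (u$i / \<Delta>$i$i) / \<Delta>$i$i"
    using d unfolding x2 by (simp add: field_simps)
qed

lemma canonical_basis_independent: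
  assumes "canonical_basis L0 L1 L2" and "cmat_scale \<alpha> L1 + cmat_scale \<beta> L2 = 0"
  shows "\<alpha> = 0 \<and> \<beta> = 0"
proof -
  obtain p1 p2 where "entry L1 p1 = 1" "entry L1 p2 = 0" "entry L2 p1 = 0" "entry L2 p2 = 1"
    using assms(1) unfolding canonical_basis_def by blast
  moreover have "\<alpha> * entry L1 p + \<beta> * entry L2 p = 0" for p
    using assms(2) by (simp add: entry_def cmat_scale_def vec_eq_iff)
  ultimately show ?thesis by (metis add_0 add.right_neutral mult_zero_right mult.right_neutral)
qed

text \<open>By \<open>z\<close>, the nonzero matrix \<open>L2\<close> has a nonzero first row, so
  its leading position is one of the two least positions; as \<open>p1\<close> precedes it, it is
  the second.\<close>

lemma canonical_basis_leading_entries: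
  assumes cb: "canonical_basis L0 L1 L2"
    and z: "L1$1$1 = 0 \<Longrightarrow> L1$1$2 = 0 \<Longrightarrow> L1 = 0" "L2$1$1 = 0 \<Longrightarrow> L2$1$2 = 0 \<Longrightarrow> L2 = 0"
  shows "L1$1$1 = 1 \<and> L1$1$2 = 0 \<and> L2$1$1 = 0 \<and> L2$1$2 = 1"
proof -
  have ne: "L1 \<noteq> 0" "L2 \<noteq> 0"
    using cb cmat.dependent_zero unfolding canonical_basis_def by blast+
  obtain p1 p2 where p: "p1 \<in> positions" "p2 \<in> positions" "prec p1 p2"
    and e: "entry L1 p1 = 1" "entry L1 p2 = 0" "entry L2 p1 = 0" "entry L2 p2 = 1"
    and z1: "\<And>q. q \<in> positions \<Longrightarrow> prec q p1 \<Longrightarrow> entry L1 q = 0"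
    and z2: "\<And>q. q \<in> positions \<Longrightarrow> prec q p2 \<Longrightarrow> entry L2 q = 0"
    using cb unfolding canonical_basis_def by blast
  have pos: "(1,1) \<in> positions" "(1,2) \<in> positions" by (simp_all add: positions_def)
  have ent: "entry A (1,1) = A$1$1" "entry A (1,2) = A$1$2" for A by (simp_all add: entry_def)
  have above: "prec (1,1) q \<and> prec (1,2) q" if "q \<in> positions" "q \<noteq> (1,1)" "q \<noteq> (1,2)" for q
    using that by (cases q) (auto simp: positions_def prec_def)
  have "p2 = (1,1) \<or> p2 = (1,2)"
    using above[OF p(2)] z2[OF pos(1)] z2[OF pos(2)] z(2) ne(2) ent by metis
  moreover have "\<not> prec q (1,1)" if "q \<in> positions" for q
    using that by (cases q) (auto simp: positions_def prec_def)
  ultimately have p2: "p2 = (1,2)" using p by blast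
  have "p1 = (1,1)"
    using p(1,3) unfolding p2 by (cases p1) (auto simp: positions_def prec_def)
  then show ?thesis using e p2 ent by simp
qed

text \<open>Since \<open>u$1\<close> is nonzero, the first row determines the coefficients of
  \<open>u\<close>, and the normalization of the canonical basis fixes that row.\<close>

lemma form_E7_0_if_rank_one:
  assumes \<Delta>: "\<Delta> = diag3 b1 b2 b3" and b: "b1 \<noteq> 0" "b2 \<noteq> 0" "b3 \<noteq> 0"
    and cb: "canonical_basis L0 L1 L2" and M: "L1 \<in> M3" "L2 \<in> M3"
    and u: "\<And>i. u$i \<noteq> 0"
    and c: "column 1 (Gam \<Delta> L1) = s1 *s u" "column 2 (Gam \<Delta> L1) = t1 *s u"
      "column 1 (Gam \<Delta> L2) = s2 *s u" "column 2 (Gam \<Delta> L2) = t2 *s u"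
  shows "form_E7_0 \<Delta> L1 L2"
proof -
  define r where "r i = u$i / \<Delta>$i$i" for i
  have d: "\<Delta>$i$i \<noteq> 0" for i using b exhaust_3[of i] by (auto simp: \<Delta> diag3_def)
  have r: "r i \<noteq> 0" for i using u d by (simp add: r_def)
  note L1 = M3_entries_of_Gam_columns[OF \<Delta> b M(1) c(1,2), folded r_def]
  note L2 = M3_entries_of_Gam_columns[OF \<Delta> b M(2) c(3,4), folded r_def]
  have "L1$1$1 = 1 \<and> L1$1$2 = 0 \<and> L2$1$1 = 0 \<and> L2$1$2 = 1"
  proof (rule canonical_basis_leading_entries[OF cb])
    assume "L1$1$1 = 0" "L1$1$2 = 0"
    then have "t1 = 0 \<and> s1 = 0" using r[of 1] L1[of 1] by auto
    then show "L1 = 0" using L1 by (simp add: vec_eq_iff forall_3)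
  next
    assume "L2$1$1 = 0" "L2$1$2 = 0"
    then have "t2 = 0 \<and> s2 = 0" using r[of 1] L2[of 1] by auto
    then show "L2 = 0" using L2 by (simp add: vec_eq_iff forall_3)
  qed
  then have e: "s1 = 1 / r 1" "t1 = 0" "t2 = 1 / r 1" "s2 = - 1 / (r 1 * \<Delta>$1$1)"
    using L1[of 1] L2[of 1] r[of 1] d[of 1] by (auto simp: field_simps add_eq_0_iff)
  define x where "x = r 2 / r 1"
  define y where "y = r 3 / r 1"
  have "x * y \<noteq> 0" using r by (simp add: x_def y_def)
  moreover have "L1 = vector [vector [1, 0, 0], vector [x, 0, 0], vector [y, 0, 0]]"
    using r[of 1] by (simp add: vec_eq_iff forall_3 L1 e x_def y_def)
  moreover have "L2 = vector [vector [0, 1, 0], vector [b_Delta3 \<Delta> * x, x, 0],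
      vector [b_Delta2 \<Delta> * y, y, 0]]"
    using r[of 1] by (simp add: vec_eq_iff forall_3 L2 e x_def y_def b_Delta2_def b_Delta3_def
        algebra_simps)
  ultimately show ?thesis unfolding form_E7_0_def by blast
qed

lemma rank_one_if_form_E7_0:
  assumes \<Delta>: "\<Delta> = diag3 b1 b2 b3" and b: "b1 \<noteq> 0" "b2 \<noteq> 0" "b3 \<noteq> 0"
    and E: "form_E7_0 \<Delta> L1 L2"
  obtains u where "\<And>i. u$i \<noteq> 0"
    "column 1 (Gam \<Delta> L1) = 1 *s u" "column 2 (Gam \<Delta> L1) = 0 *s u"
    "column 1 (Gam \<Delta> L2) = (- 1 / b1) *s u" "column 2 (Gam \<Delta> L2) = 1 *s u"
proof -
  obtain x y where xy: "x * y \<noteq> 0" and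
    L: "L1 = vector [vector [1, 0, 0], vector [x, 0, 0], vector [y, 0, 0]]"
      "L2 = vector [vector [0, 1, 0], vector [b_Delta3 \<Delta> * x, x, 0],
        vector [b_Delta2 \<Delta> * y, y, 0]]" using E unfolding form_E7_0_def by blast
  \<comment> \<open>This is the first column of \<open>Gam \<Delta> L1\<close>.\<close>
  define u :: "complex^3" where "u = vector [b1, b2 * x, b3 * y]"
  show ?thesis
  proof (rule that[of u])
    show "u$i \<noteq> 0" for i using exhaust_3[of i] xy b by (auto simp: u_def)
  qed (use b in \<open>simp_all add: vec_eq_iff forall_3 column_def Gam_diag3[OF \<Delta>],
      simp_all add: L u_def \<Delta> diag3_def b_Delta2_def b_Delta3_def field_simps\<close>)
qed

section \<open>The dichotomy between common image and common kernel\<close>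

theorem theorem46:
  fixes b1 b2 b3 :: complex
    and \<Delta> L1 L2 :: "complex^3^3"
    and L L0 :: "(complex^3^3) set"
  assumes "distinct [b1, b2, b3]"
    and "b1 \<noteq> 0" and "b2 \<noteq> 0" and "b3 \<noteq> 0"
    and "\<Delta> = diag3 b1 b2 b3"
    and "cmat.subspace L"
    and "Delta_singular \<Delta> L"
    and "cmat.dim L = 5"
    and "L0 = L \<inter> M3"
    and "cmat.dim L0 = 2"
    and "canonical_basis L0 L1 L2"
  shows "\<not> transitive_space L \<longleftrightarrow> \<not> form_E7_0 \<Delta> L1 L2"
proof -
  note b = assms(2-4) and \<Delta> = assms(5) and cb = assms(11)
  have L12: "L1 \<noteq> L2" "cmat.independent {L1, L2}" "cmat.span {L1, L2} = L \<inter> M3"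
    using cb assms(9) unfolding canonical_basis_def by blast+
  have L12L: "L1 \<in> L" "L2 \<in> L" "L1 \<in> M3" "L2 \<in> M3"
    using L12(3) cmat.span_superset[of "{L1, L2}"] by blast+
  define p1 q1 p2 q2 where pq: "p1 = column 1 (Gam \<Delta> L1)" "q1 = column 2 (Gam \<Delta> L1)"
    "p2 = column 1 (Gam \<Delta> L2)" "q2 = column 2 (Gam \<Delta> L2)"
  obtain A B where dec: "\<And>X. X \<in> L \<Longrightarrow> \<exists>\<alpha> \<beta>.
       column 1 (Gam \<Delta> X) = A *v column 3 (Gam \<Delta> X) + \<alpha> *s p1 + \<beta> *s p2 \<and>
       column 2 (Gam \<Delta> X) = B *v column 3 (Gam \<Delta> X) + \<alpha> *s q1 + \<beta> *s q2"
    and ex: "\<And>k \<alpha> \<beta>. \<exists>X\<in>L. column 3 (Gam \<Delta> X) = k \<and>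
       column 1 (Gam \<Delta> X) = A *v k + \<alpha> *s p1 + \<beta> *s p2 \<and>
       column 2 (Gam \<Delta> X) = B *v k + \<alpha> *s q1 + \<beta> *s q2"
    using Gam_parametrization[OF \<Delta> b assms(6)
        third_column_surj[OF assms(6,8) L12] L12(3)] unfolding pq by metis
  have sing: "triple (A *v k + \<alpha> *s p1 + \<beta> *s p2) (B *v k + \<alpha> *s q1 + \<beta> *s q2) k = 0" for k \<alpha> \<beta>
    using ex[of k \<alpha> \<beta>] assms(7) unfolding Delta_singular_def det_eq_triple by metis
  \<comment> \<open>Scaling the part from \<open>L \<inter> M3\<close> by \<open>t\<close> separates
    the singularity condition into its linear and quadratic terms.\<close>
  have "triple (A *v k + t *s (\<alpha> *s p1 + \<beta> *s p2)) (B *v k + t *s (\<alpha> *s q1 + \<beta> *s q2)) k = 0" for k \<alpha> \<beta> t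
    using sing[of k "t * \<alpha>" "t * \<beta>"] by (simp add: vec.scale_right_distrib add.assoc)
  note coeffs = triple_pencil_coeffs[OF this]
  \<comment> \<open>\<open>Gam \<Delta>\<close> is injective on \<open>M3\<close>, so independence
    passes from \<open>L1\<close>, \<open>L2\<close> to the pairs.\<close>
  have ind: "\<alpha> = 0 \<and> \<beta> = 0" if "\<alpha> *s p1 + \<beta> *s p2 = 0" "\<alpha> *s q1 + \<beta> *s q2 = 0" for \<alpha> \<beta>
  proof -
    let ?Y = "cmat_scale \<alpha> L1 + cmat_scale \<beta> L2"
    have M: "?Y \<in> M3" using L12L by (simp add: M3_def cmat_scale_def)
    have "column 1 (Gam \<Delta> ?Y) = 0 *s 0" "column 2 (Gam \<Delta> ?Y) = 0 *s 0"
      using that unfolding pq by (simp_all add: Gam_add Gam_cmat_scale column_add column_cmat_scale)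
    from M3_entries_of_Gam_columns[OF \<Delta> b M this] have "?Y = 0" by (simp add: vec_eq_iff forall_3)
    then show ?thesis using canonical_basis_independent[OF cb] by blast
  qed
  have common_image: "\<exists>f1 f2. (\<forall>X\<in>L. \<exists>\<alpha>. column 1 (Gam \<Delta> X) = f1 *s column 3 (Gam \<Delta> X) + \<alpha> *s u)
     \<and> (\<forall>k \<alpha> \<beta>. \<exists>X\<in>L. column 3 (Gam \<Delta> X) = k \<and>
         column 1 (Gam \<Delta> X) = f1 *s k + \<alpha> *s u \<and> column 2 (Gam \<Delta> X) = f2 *s k + \<beta> *s u)"
    if u: "u \<noteq> 0" and c: "p1 = s1 *s u" "q1 = t1 *s u" "p2 = s2 *s u" "q2 = t2 *s u"
      and D: "s1 * t2 \<noteq> s2 * t1" for u s1 t1 s2 t2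
  proof -
    have solve: "\<exists>\<alpha> \<beta>. \<alpha> * s1 + \<beta> * s2 = a \<and> \<alpha> * t1 + \<beta> * t2 = e" for a e
    proof -
      define \<delta> where "\<delta> = s1 * t2 - s2 * t1"
      have "\<delta> \<noteq> 0" using D by (simp add: \<delta>_def)
      moreover have "(a * t2 - e * s2) * s1 + (e * s1 - a * t1) * s2 = a * \<delta>"
        "(a * t2 - e * s2) * t1 + (e * s1 - a * t1) * t2 = e * \<delta>"
        unfolding \<delta>_def by algebra+
      ultimately have "(a * t2 - e * s2) / \<delta> * s1 + (e * s1 - a * t1) / \<delta> * s2 = a"
        "(a * t2 - e * s2) / \<delta> * t1 + (e * s1 - a * t1) / \<delta> * t2 = e"
        by (simp_all add: add_divide_distrib[symmetric])
      then show ?thesis by blast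
    qed
    have comb: "\<alpha> *s p1 + \<beta> *s p2 = (\<alpha> * s1 + \<beta> * s2) *s u"
      "\<alpha> *s q1 + \<beta> *s q2 = (\<alpha> * t1 + \<beta> * t2) *s u" for \<alpha> \<beta>
      unfolding c by (simp_all add: vec_eq_iff algebra_simps)
    \<comment> \<open>By \<open>D\<close> the coefficients \<open>a\<close> and \<open>e\<close> of
      \<open>u\<close> are independent, so the linear term splits into separate conditions on
      \<open>A\<close> and \<open>B\<close>.\<close>
    have "triple (a *s u) (B *v k) k + triple (A *v k) (e *s u) k = 0" for a e k
      using coeffs(2) solve[of a e] unfolding comb by metis
    from this[of 1 _ 0] this[of 0 _ 1]
    have "triple u (B *v k) k = 0" "triple u (A *v k) k = 0" for k
      by (simp_all add: triple_def algebra_simps)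
    then obtain f1 f2 and g1 g2 :: "complex^3" where
      A: "\<And>k. A *v k = f1 *s k + (g1$1 * k$1 + g1$2 * k$2 + g1$3 * k$3) *s u" and
      B: "\<And>k. B *v k = f2 *s k + (g2$1 * k$1 + g2$2 * k$2 + g2$3 * k$3) *s u"
      using scalar_plus_rank_one[OF u] by metis
    show ?thesis
    proof (rule exI[of _ f1], rule exI[of _ f2], intro conjI ballI allI)
      fix X assume "X \<in> L"
      then obtain \<alpha> \<beta> where "column 1 (Gam \<Delta> X) = A *v column 3 (Gam \<Delta> X) + \<alpha> *s p1 + \<beta> *s p2"
        using dec by blast
      then show "\<exists>\<alpha>. column 1 (Gam \<Delta> X) = f1 *s column 3 (Gam \<Delta> X) + \<alpha> *s u"
        unfolding A add.assoc comb by (metis vec.scale_left_distrib)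
    next
      fix k :: "complex^3" and a e
      \<comment> \<open>The components of \<open>A *v k\<close> and \<open>B *v k\<close> along
        \<open>u\<close> are absorbed into the free coefficients.\<close>
      define G1 where "G1 = g1$1 * k$1 + g1$2 * k$2 + g1$3 * k$3"
      define G2 where "G2 = g2$1 * k$1 + g2$2 * k$2 + g2$3 * k$3"
      obtain \<alpha> \<beta> where "\<alpha> * s1 + \<beta> * s2 = a - G1" "\<alpha> * t1 + \<beta> * t2 = e - G2"
        using solve by blast
      moreover have "A *v k = f1 *s k + G1 *s u" "B *v k = f2 *s k + G2 *s u"
        unfolding A B G1_def G2_def by blast+
      ultimately have "A *v k + \<alpha> *s p1 + \<beta> *s p2 = f1 *s k + a *s u"
        "B *v k + \<alpha> *s q1 + \<beta> *s q2 = f2 *s k + e *s u"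
        by (simp_all add: add.assoc comb vec.scale_left_distrib[symmetric])
      then show "\<exists>X\<in>L. column 3 (Gam \<Delta> X) = k \<and>
         column 1 (Gam \<Delta> X) = f1 *s k + a *s u \<and> column 2 (Gam \<Delta> X) = f2 *s k + e *s u"
        using ex[of k \<alpha> \<beta>] by simp
    qed
  qed
  have mv: "(Gam \<Delta> X *v w) = w$1 *s column 1 (Gam \<Delta> X) + w$2 *s column 2 (Gam \<Delta> X)
      + w$3 *s column 3 (Gam \<Delta> X)" for X w
    by (simp add: matrix_vector_mult_def sum_3 column_def vec_eq_iff mult.commute)
  have "transitive_space L" if E: "form_E7_0 \<Delta> L1 L2"
  proof -
    obtain u where u: "\<And>i. u$i \<noteq> 0" and
      c: "p1 = 1 *s u" "q1 = 0 *s u" "p2 = (- 1 / b1) *s u" "q2 = 1 *s u"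
      using rank_one_if_form_E7_0[OF \<Delta> b E] unfolding pq by metis
    have "u \<noteq> 0" using u[of 1] by auto
    then show ?thesis
      using common_image[OF _ c] transitive_if_rank_one_pencil[OF \<Delta> b assms(1) u] by auto
  qed
  moreover have "form_E7_0 \<Delta> L1 L2" if tr: "transitive_space L"
  proof (cases rule: rank_one_pencil_cases[of p1 p2 q1 q2, OF coeffs(1) ind, case_names ind1 ind2 image kernel])
    case (image u s1 t1 s2 t2)
    from common_image[OF this] obtain f1 where
      f1: "\<And>X. X \<in> L \<Longrightarrow> \<exists>\<alpha>. column 1 (Gam \<Delta> X) = f1 *s column 3 (Gam \<Delta> X) + \<alpha> *s u" by blast
    have "u$i \<noteq> 0" for i
    proof
      assume ui: "u$i = 0"
      define w :: "complex^3" where "w = vector [1, 0, - f1]"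
      have "w \<noteq> 0" by (simp add: w_def vec3_eq_0_iff)
      \<comment> \<open>The vector \<open>Gam \<Delta> X *v w\<close> is a multiple of
        \<open>u\<close>, whose \<open>i\<close>-th entry is zero.\<close>
      moreover have "(Gam \<Delta> X *v w) $ i = 0" if "X \<in> L" for X
        using f1[OF that] ui by (auto simp: mv w_def)
      ultimately show False using not_transitive_if_Gam_row_kernel[OF \<Delta> b] tr by blast
    qed
    then show ?thesis
      using form_E7_0_if_rank_one[OF \<Delta> b cb L12L(3,4)] image unfolding pq by blast
  next
    case (kernel s t u1 u2)
    define D where "D = (\<chi> i j. s * B$i$j - t * A$i$j)"
    have D: "D *v k = s *s (B *v k) - t *s (A *v k)" for k
      by (simp add: D_def vec_eq_iff matrix_vector_mult_def sum_3 algebra_simps)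
    have "triple u1 (D *v k) k = 0" "triple u2 (D *v k) k = 0" for k
      using coeffs(2)[of 1 0 k] coeffs(2)[of 0 1 k] unfolding kernel D
      by (simp_all add: triple_def algebra_simps)
    then obtain f where f: "\<And>k. D *v k = f *s k"
      using scalar_if_two_triples[OF kernel(2,3)] by blast
    define w :: "complex^3" where "w = vector [- t, s, - f]"
    have "w \<noteq> 0" using kernel(1) by (auto simp: w_def vec3_eq_0_iff)
    moreover have "Gam \<Delta> X *v w = 0" if X: "X \<in> L" for X
    proof -
      define k where "k = column 3 (Gam \<Delta> X)"
      obtain \<alpha> \<beta> where "column 1 (Gam \<Delta> X) = A *v k + \<alpha> *s p1 + \<beta> *s p2"
        "column 2 (Gam \<Delta> X) = B *v k + \<alpha> *s q1 + \<beta> *s q2"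
        using dec[OF X] unfolding k_def by blast
      \<comment> \<open>The contributions of \<open>\<alpha>\<close> and \<open>\<beta>\<close>
        cancel because \<open>(- t, s)\<close> annihilates the coefficient pair
        \<open>(s, t)\<close>.\<close>
      then have "Gam \<Delta> X *v w = D *v k - f *s k"
        unfolding mv k_def[symmetric] D kernel by (simp add: w_def vec_eq_iff algebra_simps)
      then show ?thesis using f by simp
    qed
    ultimately show ?thesis using not_transitive_if_Gam_row_kernel[OF \<Delta> b] tr
      by (metis zero_index)
  qed
  ultimately show ?thesis by blast
qed

end
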